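(* Let $N\in\mathbb{N}$ be such that $\mathcal{P}_N$ contains all two-variable monomials of total degree $n$, and no monomials of total degree $n+1$. Then the $N$th-order optimal polynomial approximant in the Drury-Arveson space $H^2_2$ to $1/\big(1-\tfrac{1}{\sqrt2}(z_1+z_2)\big)$ is given by $$p_N^*(z_1,z_2)=r_n\left(\frac{z_1+z_2}{\sqrt2}\right),\qquad\text{where}\qquad r_n(x)=\sum_{k=0}^n\left(1-\frac{k+1}{n+2}\right)x^k.$$
   Context: The Drury-Arveson space $H^2_2$ on the unit ball $\mathbb{B}^2\subset\mathbb{C}^2$ is the reproducing kernel Hilbert space of holomorphic functions on $\mathbb{B}^2$ with kernel $\frac{1}{1-\langle z,\lambda\rangle}$, where $\langle z,\lambda\rangle=z_1\overline{\lambda_1}+z_2\overline{\lambda_2}$; equivalently, for $f=\sum_{j,k\ge0}a_{j,k}z_1^jz_2^k$, $$\|f\|_{H^2_2}^2=\sum_{j=0}^\infty\sum_{k=0}^\infty\frac{j!\,k!}{(j+k)!}|a_{j,k}|^2.$$ The monomials are listed in degree lexicographic order, i.e. by increasing total degree with ties broken lexicographically: $\chi_0=1,\ \chi_1=z_1,\ \chi_2=z_2,\ \chi_3=z_1^2,\ \chi_4=z_1z_2,\ \chi_5=z_2^2,\ \chi_6=z_1^3,\dots$, and $\mathcal{P}_N=\mathrm{span}\{\chi_0,\dots,\chi_N\}$. The $N$th-order optimal polynomial approximant $p_N^*$ to $1/f$ is the unique polynomial minimizing $\|pf-1\|_{H^2_2}$ among all $p\in\mathcal{P}_N$. *)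

theory Defs
  imports "HOL-Analysis.Analysis" "HOL-Library.Nat_Bijection"
begin

text \<open>
  Functions on the unit ball of $\mathbb{C}^2$ are represented by total functions on
  \<^typ>\<open>complex \<times> complex\<close>, whose norm is the Euclidean one; only the values on
  \<^term>\<open>ball (0 :: complex \<times> complex) 1\<close> enter the definitions of the space and of its norm.
\<close>

definition monomial2 :: "nat \<Rightarrow> nat \<Rightarrow> complex \<times> complex \<Rightarrow> complex" where
  "monomial2 j k = (\<lambda>(z1, z2). z1 ^ j * z2 ^ k)"

definition has_ball_series :: "(complex \<times> complex \<Rightarrow> complex) \<Rightarrow> (nat \<Rightarrow> nat \<Rightarrow> complex) \<Rightarrow> bool" where
  "has_ball_series f a \<longleftrightarrow>
     (\<forall>z\<in>ball 0 1. ((\<lambda>(j, k). a j k * monomial2 j k z) has_sum f z) UNIV)"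

text \<open>The coefficient family of a function that has such an expansion is unique.\<close>

definition ball_coeff :: "(complex \<times> complex \<Rightarrow> complex) \<Rightarrow> nat \<Rightarrow> nat \<Rightarrow> complex" where
  "ball_coeff f = (THE a. has_ball_series f a)"

definition da_term :: "(complex \<times> complex \<Rightarrow> complex) \<Rightarrow> nat \<times> nat \<Rightarrow> real" where
  "da_term f = (\<lambda>(j, k). fact j * fact k / fact (j + k) * (cmod (ball_coeff f j k))\<^sup>2)"

definition drury_arveson :: "(complex \<times> complex \<Rightarrow> complex) set" where
  "drury_arveson = {f. (\<exists>a. has_ball_series f a) \<and> da_term f summable_on UNIV}"

definition da_norm :: "(complex \<times> complex \<Rightarrow> complex) \<Rightarrow> real" where
  "da_norm f = sqrt (\<Sum>\<^sub>\<infinity>jk. da_term f jk)"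

text \<open>
  Exponents in degree lexicographic order with $z_1$ before $z_2$:
  $(0,0), (1,0), (0,1), (2,0), (1,1), (0,2), (3,0), \dots$.
  The library's diagonal enumeration lists each diagonal in the opposite direction, hence the swap.
\<close>

definition deglex_exp :: "nat \<Rightarrow> nat \<times> nat" where
  "deglex_exp i = prod.swap (prod_decode i)"

definition deglex_monomial :: "nat \<Rightarrow> complex \<times> complex \<Rightarrow> complex" where
  "deglex_monomial i = (case deglex_exp i of (j, k) \<Rightarrow> monomial2 j k)"

lemma deglex_exp_bij: "bij deglex_exp"
  unfolding deglex_exp_def
  using bij_comp[OF bij_prod_decode bij_swap] by (simp add: o_def)

lemma deglex_exp_less_iff:
  assumes "deglex_exp m = (j, k)" and "deglex_exp n = (j', k')"
  shows "m < n \<longleftrightarrow> j + k < j' + k' \<or> j + k = j' + k' \<and> j > j'"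
proof -
  have enc: "i = triangle (a + b) + b" if "deglex_exp i = (a, b)" for i a b
  proof -
    have "prod_decode i = (b, a)"
      using that unfolding deglex_exp_def by (cases "prod_decode i") simp
    then have "i = prod_encode (b, a)"
      by (metis prod_decode_inverse)
    then show ?thesis
      by (simp add: prod_encode_def add.commute)
  qed
  have m: "m = triangle (j + k) + k" and n: "n = triangle (j' + k') + k'"
    using enc assms by simp_all
  have mono: "triangle a \<le> triangle b" if "a \<le> b" for a b
    using that by (induction rule: dec_induct) (simp_all add: triangle_Suc)
  have low: "triangle a + l < triangle b" if "l \<le> a" "a < b" for a b l
    using mono[of "Suc a" b] that by (simp add: triangle_Suc)
  show ?thesis
  proof (cases "j + k" "j' + k'" rule: linorder_cases)
    case less
    then show ?thesis using low[of k "j + k" "j' + k'"] unfolding m n by linarith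
  next
    case equal
    then show ?thesis unfolding m n by auto
  next
    case greater
    then show ?thesis using low[of k' "j' + k'" "j + k"] unfolding m n by linarith
  qed
qed

definition poly_space :: "nat \<Rightarrow> (complex \<times> complex \<Rightarrow> complex) set" where
  "poly_space N = {p. \<exists>c :: nat \<Rightarrow> complex. p = (\<lambda>z. \<Sum>i\<le>N. c i * deglex_monomial i z)}"

definition is_optimal_approximant ::
    "nat \<Rightarrow> (complex \<times> complex \<Rightarrow> complex) \<Rightarrow> (complex \<times> complex \<Rightarrow> complex) \<Rightarrow> bool" where
  "is_optimal_approximant N f p \<longleftrightarrow>
     f \<in> drury_arveson \<and> p \<in> poly_space N \<and>
     (\<forall>q\<in>poly_space N. da_norm (\<lambda>z. p z * f z - 1) \<le> da_norm (\<lambda>z. q z * f z - 1))"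

definition r_poly :: "nat \<Rightarrow> complex \<Rightarrow> complex" where
  "r_poly n x = (\<Sum>k=0..n. (1 - of_nat (k + 1) / of_nat (n + 2)) * x ^ k)"

end

theory Submission
  imports Defs "HOL-Complex_Analysis.Cauchy_Integral_Formula"
begin

text \<open>
  Write $L = (z_1 + z_2)/\sqrt 2$ and $f = 1 - L$. Multiplying out,
  $$r_n(L) f - 1 = -\frac{1}{n+2} \sum_{k=0}^{n+1} L^k$$
  (\<open>r_poly_times_one_minus\<close>). With $\lambda = (1/\sqrt 2, 1/\sqrt 2)$ one has
  $L = \langle z, \lambda\rangle$, so the sum on the right is the geometric series of the kernel
  $1/(1 - \langle z, \lambda\rangle)$ cut off after degree $n+1$. Although $\lambda$ lies on the
  unit sphere, where the kernel itself has infinite norm, the truncated kernel reproduces: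
  its inner product with a polynomial $h$ of degree at most $n+1$ is $h(\lambda)$. Since
  $f(\lambda) = 0$, the residual $r_n(L) f - 1$ is orthogonal to $q f$ for every polynomial $q$
  of degree at most $n$, and so, by Pythagoras,
  $$\|q f - 1\|^2 = \|r_n(L) f - 1\|^2 + \|(q - r_n(L)) f\|^2$$
  (\<open>da_norm_add_kernel\<close>). Hence $r_n(L)$ is optimal, and any other optimal $q$ satisfies
  $(q - r_n(L)) f = 0$. As $f$ has no zero in the ball, $q = r_n(L)$ there, and then
  everywhere, by comparing coefficients.

  The norm is defined through the coefficients of a power series on the ball. For it to be
  computable on polynomials these coefficients have to be unique (\<open>has_ball_series_unique\<close>).
  Uniqueness also makes the monomials linearly independent, so that the hypotheses on $N$ force
  the approximating space to be that of all polynomials of degree at most $n$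
  (\<open>poly_space_eq_polys_upto\<close>).
\<close>

section \<open>Uniqueness of coefficients\<close>

text \<open>Zeros of a power series with a nonzero coefficient of positive order are isolated.\<close>

lemma powser_zero_imp_coeff_zero:
  fixes a :: "nat \<Rightarrow> complex"
  assumes "r > 0" and sums: "\<And>x. norm x < r \<Longrightarrow> (\<lambda>n. a n * x ^ n) sums 0"
  shows "a m = 0"
proof (rule ccontr)
  assume am: "a m \<noteq> 0"
  have "a 0 = 0"
    using sums[of 0] \<open>r > 0\<close> by simp
  with am have "m > 0"
    by (cases m) auto
  obtain s where "0 < s" and s: "\<And>z. z \<in> cball (0::complex) s - {0} \<Longrightarrow> (0::complex) \<noteq> 0"
    by (rule powser_0_nonzero[of r 0 a "\<lambda>_. 0" m]) (use assms am \<open>m > 0\<close> in auto)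
  have "complex_of_real s \<in> cball 0 s - {0}"
    using \<open>0 < s\<close> by simp
  with s show False
    by blast
qed

text \<open>
  For fixed $y$, summing over $k$ first leaves a power series in $x$ that vanishes, so each
  row $\sum_k a_{jk} y^k$ is zero; each row is in turn a vanishing power series in $y$.
\<close>

lemma double_powser_zero_imp_coeff_zero:
  fixes a :: "nat \<Rightarrow> nat \<Rightarrow> complex"
  assumes "r > 0"
    and zero: "\<And>x y. norm x < r \<Longrightarrow> norm y < r \<Longrightarrow>
      ((\<lambda>(j, k). a j k * (x ^ j * y ^ k)) has_sum 0) UNIV"
  shows "a j k = 0"
proof -
  have rows: "((\<lambda>k. a j k * y ^ k) has_sum 0) UNIV" if y: "norm y < r" for y j
  proof -
    \<comment> \<open>Summability of a row follows from that of the double series at any nonzero \<open>x\<close>.\<close>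
    have row: "(\<lambda>k. a j k * y ^ k) summable_on UNIV" for j
    proof -
      define x where "x = complex_of_real (r / 2)"
      have x: "norm x < r" "x \<noteq> 0"
        using \<open>r > 0\<close> by (auto simp: x_def)
      have "(\<lambda>(j, k). a j k * (x ^ j * y ^ k)) summable_on Pair j ` UNIV"
        using has_sum_imp_summable[OF zero[OF x(1) y]] by (rule summable_on_subset_banach) simp
      then have "(\<lambda>k. a j k * (x ^ j * y ^ k)) summable_on UNIV"
        by (subst (asm) summable_on_reindex) (auto simp: o_def inj_on_def)
      then have "(\<lambda>k. inverse (x ^ j) * (a j k * (x ^ j * y ^ k))) summable_on UNIV"
        by (rule summable_on_cmult_right)
      then show ?thesis
        using x(2) by (simp add: field_simps)
    qed
    define A where "A j = (\<Sum>\<^sub>\<infinity>k. a j k * y ^ k)" for j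
    have A: "((\<lambda>k. a j k * y ^ k) has_sum A j) UNIV" for j
      unfolding A_def using row by (rule has_sum_infsum)
    have "(\<lambda>j. A j * x ^ j) sums 0" if x: "norm x < r" for x
    proof -
      have "((\<lambda>j. A j * x ^ j) has_sum 0) UNIV"
      proof (rule has_sum_Sigma[where B = "\<lambda>_. UNIV"])
        show "uniformly_continuous_on UNIV (\<lambda>(x::complex, y). x + y)"
          by (rule isUCont_plus)
        show "((\<lambda>(j, k). a j k * (x ^ j * y ^ k)) has_sum 0) (UNIV \<times> UNIV)"
          using zero[OF x y] by simp
        show "((\<lambda>k. case (j, k) of (j, k) \<Rightarrow> a j k * (x ^ j * y ^ k)) has_sum A j * x ^ j) UNIV" for j
          using has_sum_cmult_left[OF A[of j], of "x ^ j"] by (simp add: mult_ac)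
      qed
      then show ?thesis
        by (rule has_sum_imp_sums)
    qed
    then have "A j = 0"
      by (rule powser_zero_imp_coeff_zero[OF \<open>r > 0\<close>])
    with A[of j] show ?thesis
      by simp
  qed
  show ?thesis
    by (rule powser_zero_imp_coeff_zero[OF \<open>r > 0\<close>]) (intro has_sum_imp_sums rows)
qed

lemma has_ball_series_unique:
  assumes "has_ball_series f a" and "has_ball_series f b"
  shows "a = b"
proof (intro ext)
  fix j k
  have "(\<lambda>j k. a j k - b j k) j k = 0"
  proof (rule double_powser_zero_imp_coeff_zero[of "1 / 2"])
    fix x y :: complex
    \<comment> \<open>The bidisc of radius \<open>1 / 2\<close> lies inside the Euclidean unit ball.\<close>
    assume "norm x < 1 / 2" and "norm y < 1 / 2"
    then have "(x, y) \<in> ball 0 1"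
      using norm_Pair_le[of x y] by simp
    then have "((\<lambda>s. (\<lambda>(j, k). a j k * monomial2 j k (x, y)) s
        + - (\<lambda>(j, k). b j k * monomial2 j k (x, y)) s) has_sum f (x, y) + - f (x, y)) UNIV"
      using assms unfolding has_ball_series_def
      by (intro has_sum_add has_sum_uminusI) blast+
    then show "((\<lambda>(j, k). (a j k - b j k) * (x ^ j * y ^ k)) has_sum 0) UNIV"
      by (simp add: monomial2_def case_prod_unfold algebra_simps)
  qed simp
  then show "a j k = b j k"
    by simp
qed

lemma ball_coeff_eq:
  assumes "has_ball_series f a"
  shows "ball_coeff f = a"
  unfolding ball_coeff_def using assms has_ball_series_unique by blast

section \<open>Polynomials and their norms\<close>

text \<open>
  The set \<open>S\<close> of exponents is a parameter so that single monomials, initial segments of the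
  degree lexicographic order and polynomials of bounded degree are all instances.
\<close>

definition polyfun :: "(nat \<times> nat) set \<Rightarrow> (nat \<times> nat \<Rightarrow> complex) \<Rightarrow> complex \<times> complex \<Rightarrow> complex" where
  "polyfun S b z = (\<Sum>s\<in>S. b s * monomial2 (fst s) (snd s) z)"

definition da_weight :: "nat \<times> nat \<Rightarrow> real" where
  "da_weight = (\<lambda>(j, k). fact j * fact k / fact (j + k))"

lemma da_weight_pos: "da_weight s > 0"
  by (simp add: da_weight_def split: prod.split)

lemma has_ball_series_polyfun:
  assumes "finite S"
  shows "has_ball_series (polyfun S b) (\<lambda>j k. if (j, k) \<in> S then b (j, k) else 0)"
  unfolding has_ball_series_def
proof
  fix z :: "complex \<times> complex"
  have "((\<lambda>s. b s * monomial2 (fst s) (snd s) z) has_sum polyfun S b z) S"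
    unfolding polyfun_def using assms by (rule has_sum_finite)
  then show "((\<lambda>(j, k). (if (j, k) \<in> S then b (j, k) else 0) * monomial2 j k z)
      has_sum polyfun S b z) UNIV"
    by (subst has_sum_cong_neutral[where T = S]) (auto split: prod.split)
qed

lemma da_term_polyfun:
  assumes "finite S"
  shows "da_term (polyfun S b) = (\<lambda>s. if s \<in> S then da_weight s * (cmod (b s))\<^sup>2 else 0)"
  unfolding da_term_def ball_coeff_eq[OF has_ball_series_polyfun[OF assms]]
  by (auto simp: da_weight_def)

lemma da_norm_polyfun:
  assumes "finite S"
  shows "da_norm (polyfun S b) = sqrt (\<Sum>s\<in>S. da_weight s * (cmod (b s))\<^sup>2)"
proof -
  have "infsum (da_term (polyfun S b)) UNIV = infsum (\<lambda>s. da_weight s * (cmod (b s))\<^sup>2) S"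
    unfolding da_term_polyfun[OF assms] by (rule infsum_cong_neutral) auto
  with assms show ?thesis
    by (simp add: da_norm_def)
qed

lemma polyfun_in_drury_arveson:
  assumes "finite S"
  shows "polyfun S b \<in> drury_arveson"
proof -
  have "(\<lambda>s. da_weight s * (cmod (b s))\<^sup>2) summable_on S"
    using assms by simp
  then have "da_term (polyfun S b) summable_on UNIV"
    unfolding da_term_polyfun[OF assms] by (subst summable_on_cong_neutral[where T = S]) auto
  then show ?thesis
    unfolding drury_arveson_def using has_ball_series_polyfun[OF assms] by blast
qed

lemma polyfun_zero_on_ball_imp_coeff_zero:
  assumes "finite S" and "\<And>z. z \<in> ball 0 1 \<Longrightarrow> polyfun S b z = 0" and "s \<in> S"
  shows "b s = 0"
proof -
  have "has_ball_series (polyfun S b) (\<lambda>_ _. 0)"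
    using assms(2) by (simp add: has_ball_series_def case_prod_unfold)
  with has_ball_series_polyfun[OF assms(1)]
  have "(\<lambda>j k. if (j, k) \<in> S then b (j, k) else 0) = (\<lambda>_ _. 0)"
    by (rule has_ball_series_unique)
  from fun_cong[OF fun_cong[OF this, of "fst s"], of "snd s"] assms(3) show ?thesis
    by simp
qed

lemma polyfun_add: "polyfun S b z + polyfun S c z = polyfun S (\<lambda>s. b s + c s) z"
  by (simp add: polyfun_def sum.distrib algebra_simps)

lemma polyfun_scale: "\<alpha> * polyfun S b z = polyfun S (\<lambda>s. \<alpha> * b s) z"
  by (simp add: polyfun_def sum_distrib_left mult.assoc)

section \<open>Polynomials of bounded total degree\<close>

definition exps_upto :: "nat \<Rightarrow> (nat \<times> nat) set" where
  "exps_upto d = {(j, k). j + k \<le> d}"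

definition polys_upto :: "nat \<Rightarrow> (complex \<times> complex \<Rightarrow> complex) set" where
  "polys_upto d = range (polyfun (exps_upto d))"

lemma finite_exps_upto [simp]: "finite (exps_upto d)"
  by (rule finite_subset[of _ "{..d} \<times> {..d}"]) (auto simp: exps_upto_def)

lemma polys_upto_add:
  "p \<in> polys_upto d \<Longrightarrow> q \<in> polys_upto d \<Longrightarrow> (\<lambda>z. p z + q z) \<in> polys_upto d"
  unfolding polys_upto_def by (auto simp: polyfun_add)

lemma polys_upto_scale: "p \<in> polys_upto d \<Longrightarrow> (\<lambda>z. \<alpha> * p z) \<in> polys_upto d"
  unfolding polys_upto_def by (auto simp: polyfun_scale)

lemma polys_upto_diff:
  assumes "p \<in> polys_upto d" and "q \<in> polys_upto d"
  shows "(\<lambda>z. p z - q z) \<in> polys_upto d"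
  using polys_upto_add[OF assms(1) polys_upto_scale[OF assms(2), of "-1"]] by simp

lemma polys_upto_sum:
  assumes "\<And>s. s \<in> S \<Longrightarrow> g s \<in> polys_upto d"
  shows "(\<lambda>z. \<Sum>s\<in>S. g s z) \<in> polys_upto d"
  using assms
proof (induction S rule: infinite_finite_induct)
  case (insert s S)
  then show ?case
    by (auto intro: polys_upto_add)
qed (auto simp: polys_upto_def image_iff polyfun_def fun_eq_iff intro!: exI[of _ "\<lambda>_. 0"])

lemma monomial2_in_polys_upto:
  assumes "j + k \<le> d"
  shows "monomial2 j k \<in> polys_upto d"
proof -
  have "monomial2 j k z = polyfun (exps_upto d) (\<lambda>s. if s = (j, k) then 1 else 0) z" for z
  proof -
    have "(j, k) \<in> exps_upto d"
      using assms by (simp add: exps_upto_def)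
    then show ?thesis
      by (simp add: polyfun_def if_distrib[of "\<lambda>c. c * _"] cong: if_cong)
  qed
  then show ?thesis
    unfolding polys_upto_def by (metis ext rangeI)
qed

text \<open>
  Each monomial times $1 - \mu (z_1 + z_2)$ is a combination of that monomial and its two
  neighbours of the next degree.
\<close>

lemma polys_upto_times_linear:
  assumes "p \<in> polys_upto d"
  shows "(\<lambda>z. p z * (1 - \<mu> * (fst z + snd z))) \<in> polys_upto (d + 1)"
proof -
  from assms obtain b where p: "p = polyfun (exps_upto d) b"
    unfolding polys_upto_def by blast
  have "(\<lambda>z. \<Sum>s\<in>exps_upto d. b s * (monomial2 (fst s) (snd s) z
      - \<mu> * (monomial2 (Suc (fst s)) (snd s) z + monomial2 (fst s) (Suc (snd s)) z)))
      \<in> polys_upto (d + 1)"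
    by (intro polys_upto_sum polys_upto_scale polys_upto_diff polys_upto_add monomial2_in_polys_upto)
      (auto simp: exps_upto_def)
  also have "(\<lambda>z. \<Sum>s\<in>exps_upto d. b s * (monomial2 (fst s) (snd s) z
      - \<mu> * (monomial2 (Suc (fst s)) (snd s) z + monomial2 (fst s) (Suc (snd s)) z)))
      = (\<lambda>z. p z * (1 - \<mu> * (fst z + snd z)))"
    unfolding p polyfun_def sum_distrib_right
    by (intro ext sum.cong refl) (simp add: monomial2_def case_prod_unfold algebra_simps)
  finally show ?thesis .
qed

lemma poly_space_eq_range_polyfun: "poly_space N = range (polyfun (deglex_exp ` {..N}))"
proof -
  have inj: "inj_on deglex_exp {..N}"
    using deglex_exp_bij by (meson bij_def inj_on_subset subset_UNIV)
  have eq: "polyfun (deglex_exp ` {..N}) b = (\<lambda>z. \<Sum>i\<le>N. b (deglex_exp i) * deglex_monomial i z)" for b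
    unfolding polyfun_def
    by (simp add: sum.reindex[OF inj] deglex_monomial_def case_prod_unfold fun_eq_iff)
  show ?thesis
  proof (intro equalityI subsetI)
    fix p assume "p \<in> poly_space N"
    then obtain c where "p = (\<lambda>z. \<Sum>i\<le>N. c i * deglex_monomial i z)"
      unfolding poly_space_def by blast
    also have "\<dots> = polyfun (deglex_exp ` {..N}) (\<lambda>s. c (inv deglex_exp s))"
      unfolding eq using deglex_exp_bij by (simp add: bij_is_inj)
    finally show "p \<in> range (polyfun (deglex_exp ` {..N}))"
      by blast
  qed (auto simp: poly_space_def eq intro: exI[of _ "\<lambda>i. _ (deglex_exp i)"])
qed

text \<open>
  No monomial is a combination of the others: two finite expansions of the same
  function have the same coefficients.
\<close>

lemma monomial2_in_poly_space_iff:
  "monomial2 j k \<in> poly_space N \<longleftrightarrow> (j, k) \<in> deglex_exp ` {..N}"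
proof -
  define S where "S = deglex_exp ` {..N}"
  have [simp]: "finite S"
    by (simp add: S_def)
  have mono: "monomial2 j k = polyfun {(j, k)} (\<lambda>_. 1)"
    by (simp add: polyfun_def fun_eq_iff)
  show ?thesis
    unfolding poly_space_eq_range_polyfun S_def[symmetric]
  proof
    assume "monomial2 j k \<in> range (polyfun S)"
    then obtain b where b: "monomial2 j k = polyfun S b"
      by blast
    have "(\<lambda>j' k'. if (j', k') \<in> {(j, k)} then 1 else 0) =
        (\<lambda>j' k'. if (j', k') \<in> S then b (j', k') else 0)"
      using has_ball_series_polyfun[of "{(j, k)}" "\<lambda>_. 1"] has_ball_series_polyfun[of S b]
      unfolding mono[symmetric] b[symmetric] by (intro has_ball_series_unique) auto
    from fun_cong[OF fun_cong[OF this, of j], of k] show "(j, k) \<in> S"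
      by (auto split: if_splits)
  next
    assume "(j, k) \<in> S"
    then have "monomial2 j k = polyfun S (\<lambda>s. if s = (j, k) then 1 else 0)"
      by (simp add: polyfun_def fun_eq_iff if_distrib[of "\<lambda>c. c * _"] cong: if_cong)
    then show "monomial2 j k \<in> range (polyfun S)"
      by blast
  qed
qed

text \<open>
  Within a given degree, $z_1^n$ comes first and $z_2^n$ last in the degree lexicographic order.
  So the presence of $z_2^n$ brings in every monomial of degree at most $n$, and the absence of
  $z_1^{n+1}$ excludes every monomial of larger degree.
\<close>

lemma poly_space_eq_polys_upto:
  assumes "monomial2 0 n \<in> poly_space N" and "monomial2 (n + 1) 0 \<notin> poly_space N"
  shows "poly_space N = polys_upto n"
proof -
  obtain l where l: "l \<le> N" "deglex_exp l = (0, n)"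
    using assms(1) unfolding monomial2_in_poly_space_iff by (metis atMost_iff imageE)
  obtain m where m: "deglex_exp m = (n + 1, 0)"
    using deglex_exp_bij by (metis bij_pointE)
  then have "N < m"
    using assms(2) unfolding monomial2_in_poly_space_iff by (metis atMost_iff image_eqI not_less)
  have "deglex_exp i \<in> exps_upto n \<longleftrightarrow> i \<le> N" for i
  proof -
    obtain j k where jk: "deglex_exp i = (j, k)"
      by fastforce
    show ?thesis
    proof
      assume "deglex_exp i \<in> exps_upto n"
      then have "\<not> l < i"
        using deglex_exp_less_iff[OF l(2) jk] jk by (auto simp: exps_upto_def)
      with l(1) show "i \<le> N"
        by simp
    next
      assume "i \<le> N"
      with \<open>N < m\<close> have "i < m"
        by simp
      then show "deglex_exp i \<in> exps_upto n"
        using deglex_exp_less_iff[OF jk m] jk by (auto simp: exps_upto_def)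
    qed
  qed
  then have "deglex_exp ` {..N} = exps_upto n"
    using surjD[OF bij_is_surj[OF deglex_exp_bij]] by (fastforce simp: image_iff)
  then show ?thesis
    by (simp add: poly_space_eq_range_polyfun polys_upto_def)
qed

section \<open>The reproducing property\<close>

text \<open>
  By the binomial theorem the coefficient of $z_1^j z_2^k$ in $(\mu (z_1 + z_2))^{j+k}$ is
  $\mu^{j+k}$ divided by exactly the Drury--Arveson weight $j!\,k!/(j+k)!$. This is what makes
  the powers of a linear form reproducing.
\<close>

lemma sum_powers_eq_polyfun:
  "(\<Sum>k\<le>m. \<alpha> k * (\<mu> * (fst z + snd z)) ^ k)
    = polyfun (exps_upto m)
        (\<lambda>s. \<alpha> (fst s + snd s) * \<mu> ^ (fst s + snd s) / of_real (da_weight s)) z"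
proof -
  have "(\<mu> * (fst z + snd z)) ^ k
      = (\<Sum>i\<le>k. \<mu> ^ k / of_real (da_weight (i, k - i)) * monomial2 i (k - i) z)" for k
  proof -
    have "(\<mu> * (fst z + snd z)) ^ k
        = (\<Sum>i\<le>k. \<mu> ^ k * (of_nat (k choose i) * fst z ^ i * snd z ^ (k - i)))"
      by (simp add: power_mult_distrib binomial_ring sum_distrib_left)
    also have "\<dots> = (\<Sum>i\<le>k. \<mu> ^ k / of_real (da_weight (i, k - i)) * monomial2 i (k - i) z)"
      by (intro sum.cong refl)
        (simp add: da_weight_def monomial2_def case_prod_unfold binomial_fact)
    finally show ?thesis .
  qed
  then have "(\<Sum>k\<le>m. \<alpha> k * (\<mu> * (fst z + snd z)) ^ k)
      = (\<Sum>k\<le>m. \<Sum>i\<le>k. \<alpha> k * \<mu> ^ k / of_real (da_weight (i, k - i)) * monomial2 i (k - i) z)"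
    by (simp add: sum_distrib_left mult.assoc)
  also have "\<dots> = (\<Sum>k\<le>m. \<Sum>i\<le>k. (\<lambda>i j. \<alpha> (i + j) * \<mu> ^ (i + j) / of_real (da_weight (i, j))
      * monomial2 i j z) i (k - i))"
    by (intro sum.cong refl) simp
  also have "\<dots> = (\<Sum>(i, j)\<in>{(i, j). i + j \<le> m}. \<alpha> (i + j) * \<mu> ^ (i + j) / of_real (da_weight (i, j))
      * monomial2 i j z)"
    by (rule sum.triangle_reindex_eq[symmetric])
  also have "\<dots> = polyfun (exps_upto m)
      (\<lambda>s. \<alpha> (fst s + snd s) * \<mu> ^ (fst s + snd s) / of_real (da_weight s)) z"
    by (simp add: polyfun_def exps_upto_def case_prod_unfold)
  finally show ?thesis .
qed

text \<open>
  The sum of powers is the kernel at $(\mu, \mu)$ truncated after degree $m$. In its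
  inner product with $h$ the weights cancel and leave $h(\mu, \mu)$, so a zero of $h$ at that
  point means orthogonality.
\<close>

lemma da_norm_add_kernel:
  fixes \<mu> c :: real
  assumes h: "h \<in> polys_upto m" and zero: "h (of_real \<mu>, of_real \<mu>) = 0"
  shows "(da_norm (\<lambda>z. of_real c * (\<Sum>k\<le>m. (of_real \<mu> * (fst z + snd z)) ^ k) + h z))\<^sup>2
    = (da_norm (\<lambda>z. of_real c * (\<Sum>k\<le>m. (of_real \<mu> * (fst z + snd z)) ^ k)))\<^sup>2 + (da_norm h)\<^sup>2"
proof -
  obtain b where b: "h = polyfun (exps_upto m) b"
    using h unfolding polys_upto_def by blast
  define u where "u s = c * \<mu> ^ (fst s + snd s) / da_weight s" for s
  have K: "of_real c * (\<Sum>k\<le>m. (of_real \<mu> * (fst z + snd z)) ^ k)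
      = polyfun (exps_upto m) (\<lambda>s. of_real (u s)) z" for z
    using sum_powers_eq_polyfun[where \<alpha> = "\<lambda>_. of_real c" and \<mu> = "of_real \<mu>"]
    by (simp add: sum_distrib_left u_def)
  have sq: "(da_norm (polyfun (exps_upto m) a))\<^sup>2
      = (\<Sum>s\<in>exps_upto m. da_weight s * (cmod (a s))\<^sup>2)" for a
    by (simp add: da_norm_polyfun sum_nonneg da_weight_pos less_imp_le)
  \<comment> \<open>The coefficients \<open>u s\<close> are real, so the real part of the inner product is a sum over \<open>Re (b s)\<close>.\<close>
  have "(\<Sum>s\<in>exps_upto m. da_weight s * (u s * Re (b s)))
      = Re (of_real c * (\<Sum>s\<in>exps_upto m. b s * of_real \<mu> ^ (fst s + snd s)))"
    unfolding sum_distrib_left Re_sum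
    by (intro sum.cong refl)
      (use da_weight_pos in \<open>simp add: u_def less_imp_neq[symmetric] flip: of_real_power\<close>)
  also have "\<dots> = 0"
    using zero by (simp add: b polyfun_def monomial2_def power_add)
  finally have cross: "(\<Sum>s\<in>exps_upto m. da_weight s * (u s * Re (b s))) = 0" .
  have "da_weight s * (cmod (of_real (u s) + b s))\<^sup>2 = da_weight s * (cmod (of_real (u s)))\<^sup>2
      + da_weight s * (cmod (b s))\<^sup>2 + 2 * (da_weight s * (u s * Re (b s)))" for s
    unfolding cmod_power2 by (simp add: power2_eq_square algebra_simps)
  then show ?thesis
    unfolding K unfolding b polyfun_add sq
    by (simp only: sum.distrib sum_distrib_left[symmetric] cross mult_zero_right add_0_right)
qed

lemma da_norm_eq_zero_imp:
  assumes "h \<in> polys_upto d" and "da_norm h = 0"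
  shows "h z = 0"
proof -
  obtain b where b: "h = polyfun (exps_upto d) b"
    using assms(1) unfolding polys_upto_def by blast
  have "(\<Sum>s\<in>exps_upto d. da_weight s * (cmod (b s))\<^sup>2) = 0"
    using assms(2) by (simp add: b da_norm_polyfun)
  then have "\<forall>s\<in>exps_upto d. da_weight s * (cmod (b s))\<^sup>2 = 0"
    by (subst (asm) sum_nonneg_eq_0_iff) (auto simp: da_weight_pos less_imp_le)
  then have "b s = 0" if "s \<in> exps_upto d" for s
    using that da_weight_pos[of s] by auto
  then show ?thesis
    by (simp add: b polyfun_def)
qed

text \<open>
  Cauchy--Schwarz against the vector $(1, 1)$. It keeps the zeros of $1 - (z_1 + z_2)/\sqrt 2$
  out of the open unit ball.
\<close>

lemma norm_add_le_sqrt2: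
  fixes z :: "complex \<times> complex"
  shows "cmod (fst z + snd z) \<le> sqrt 2 * norm z"
proof -
  have "cmod (fst z + snd z) \<le> cmod (fst z) + cmod (snd z)"
    by (rule norm_triangle_ineq)
  also have "\<dots> \<le> sqrt (2 * ((cmod (fst z))\<^sup>2 + (cmod (snd z))\<^sup>2))"
    using sum_squares_bound[of "cmod (fst z)" "cmod (snd z)"]
    by (intro real_le_rsqrt) (simp add: power2_sum)
  also have "\<dots> = sqrt 2 * norm z"
    by (simp only: norm_prod_def real_sqrt_mult)
  finally show ?thesis .
qed

text \<open>
  The coefficients of $r_n$ fall by $1/(n+2)$ at each step and would reach $0$ at degree $n+1$,
  so multiplication by $1 - x$ gives $-1/(n+2)$ in all degrees from $1$ to $n+1$.
  The constant coefficient $1 - 1/(n+2)$ becomes the same number after subtracting $1$.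
\<close>

lemma r_poly_times_one_minus:
  "r_poly n x * (1 - x) - 1 = - 1 / of_nat (n + 2) * (\<Sum>k\<le>n + 1. x ^ k)"
proof -
  define c :: complex where "c = 1 / of_nat (n + 2)"
  have c: "c * of_nat (n + 2) = 1"
    using of_nat_eq_0_iff[of "n + 2", where 'a = complex]
    by (simp add: c_def del: of_nat_add of_nat_eq_0_iff)
  \<comment> \<open>For the induction the slope \<open>c\<close> is kept independent of the number \<open>m\<close> of terms.\<close>
  have part: "(\<Sum>k=0..m. (1 - c * of_nat (k + 1)) * x ^ k) * (1 - x)
      = 1 - (1 - c * of_nat (m + 1)) * x ^ (m + 1) - c * (\<Sum>k\<le>m. x ^ k)" for m
    by (induction m) (simp_all add: algebra_simps)
  have "r_poly n x * (1 - x) - 1 = - ((1 - c * of_nat (n + 1)) * x ^ (n + 1)) - c * (\<Sum>k\<le>n. x ^ k)"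
    using part[of n] by (simp add: r_poly_def c_def)
  also have "1 - c * of_nat (n + 1) = c"
    using c by (simp add: algebra_simps)
  finally show ?thesis
    by (simp add: c_def algebra_simps)
qed

theorem proposition25:
  fixes N n :: nat and p :: "complex \<times> complex \<Rightarrow> complex"
  assumes "\<And>j k. j + k = n \<Longrightarrow> monomial2 j k \<in> poly_space N"
    and "\<And>j k. j + k = n + 1 \<Longrightarrow> monomial2 j k \<notin> poly_space N"
  shows "is_optimal_approximant N (\<lambda>(z1, z2). 1 - 1 / complex_of_real (sqrt 2) * (z1 + z2)) p
     \<longleftrightarrow> p = (\<lambda>(z1, z2). r_poly n ((z1 + z2) / complex_of_real (sqrt 2)))"
proof -
  define \<mu> :: real where "\<mu> = 1 / sqrt 2"
  define f where "f = (\<lambda>z :: complex \<times> complex. 1 - of_real \<mu> * (fst z + snd z))"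
  define P where "P = (\<lambda>z :: complex \<times> complex. r_poly n (of_real \<mu> * (fst z + snd z)))"
  have f_eq: "(\<lambda>(z1, z2). 1 - 1 / complex_of_real (sqrt 2) * (z1 + z2)) = f"
    by (auto simp: f_def \<mu>_def)
  have P_eq: "(\<lambda>(z1, z2). r_poly n ((z1 + z2) / complex_of_real (sqrt 2))) = P"
    by (auto simp: P_def \<mu>_def)
  have space: "poly_space N = polys_upto n"
    by (rule poly_space_eq_polys_upto) (use assms in auto)

  have "f \<in> drury_arveson"
  proof -
    have "(\<lambda>z. monomial2 0 0 z * (1 - of_real \<mu> * (fst z + snd z))) \<in> polys_upto (0 + 1)"
      by (intro polys_upto_times_linear monomial2_in_polys_upto) simp
    then have "f \<in> polys_upto 1"
      by (simp add: monomial2_def f_def case_prod_unfold)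
    then show ?thesis
      unfolding polys_upto_def using polyfun_in_drury_arveson[OF finite_exps_upto] by blast
  qed
  have P: "P \<in> polys_upto n"
    unfolding P_def r_poly_def atLeast0AtMost sum_powers_eq_polyfun polys_upto_def by blast

  have zero: "f (of_real \<mu>, of_real \<mu>) = 0"
  proof -
    have "\<mu> * (\<mu> + \<mu>) = 1"
      by (simp add: \<mu>_def)
    then show ?thesis
      unfolding f_def fst_conv snd_conv of_real_add[symmetric] of_real_mult[symmetric] by simp
  qed
  have pythagoras: "(da_norm (\<lambda>z. q z * f z - 1))\<^sup>2
      = (da_norm (\<lambda>z. P z * f z - 1))\<^sup>2 + (da_norm (\<lambda>z. (q z - P z) * f z))\<^sup>2"
    and mult_f: "(\<lambda>z. (q z - P z) * f z) \<in> polys_upto (n + 1)"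
    if q: "q \<in> polys_upto n" for q
  proof -
    show *: "(\<lambda>z. (q z - P z) * f z) \<in> polys_upto (n + 1)"
      unfolding f_def by (intro polys_upto_times_linear polys_upto_diff q P)
    have R: "P z * f z - 1
        = of_real (- 1 / (n + 2)) * (\<Sum>k\<le>n + 1. (of_real \<mu> * (fst z + snd z)) ^ k)" for z
      using r_poly_times_one_minus[of n "of_real \<mu> * (fst z + snd z)"]
      by (simp add: P_def f_def)
    have "q z * f z - 1 = (P z * f z - 1) + (q z - P z) * f z" for z
      by (simp add: algebra_simps)
    then show "(da_norm (\<lambda>z. q z * f z - 1))\<^sup>2
      = (da_norm (\<lambda>z. P z * f z - 1))\<^sup>2 + (da_norm (\<lambda>z. (q z - P z) * f z))\<^sup>2"
      unfolding R using da_norm_add_kernel[OF *, of \<mu> "- 1 / (n + 2)"] zero by simp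
  qed
  have nonneg: "da_norm (\<lambda>z. q z * f z - 1) \<ge> 0" for q
    by (auto simp: da_norm_def da_term_def case_prod_unfold intro!: infsum_nonneg)

  show ?thesis
    unfolding f_eq P_eq
  proof
    assume "p = P"
    moreover have "da_norm (\<lambda>z. P z * f z - 1) \<le> da_norm (\<lambda>z. q z * f z - 1)"
      if "q \<in> polys_upto n" for q
      by (rule power2_le_imp_le[OF _ nonneg]) (simp add: pythagoras[OF that])
    ultimately show "is_optimal_approximant N f p"
      unfolding is_optimal_approximant_def space using P \<open>f \<in> drury_arveson\<close> by blast
  next
    assume "is_optimal_approximant N f p"
    then have p: "p \<in> polys_upto n"
      and le: "da_norm (\<lambda>z. p z * f z - 1) \<le> da_norm (\<lambda>z. P z * f z - 1)"
      unfolding is_optimal_approximant_def space using P by blast+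
    have "(da_norm (\<lambda>z. p z * f z - 1))\<^sup>2 \<le> (da_norm (\<lambda>z. P z * f z - 1))\<^sup>2"
      using le nonneg by (rule power_mono)
    with pythagoras[OF p] have "da_norm (\<lambda>z. (p z - P z) * f z) = 0"
      by simp
    then have prod: "(p z - P z) * f z = 0" for z
      using da_norm_eq_zero_imp[OF mult_f[OF p]] by blast
    \<comment> \<open>\<open>f\<close> does vanish at some points outside the ball, so \<open>p = P\<close> is obtained on the ball first.\<close>
    have f_nz: "f z \<noteq> 0" if "z \<in> ball 0 1" for z
    proof
      assume "f z = 0"
      then have "cmod (of_real \<mu> * (fst z + snd z)) = 1"
        by (simp add: f_def)
      then have "cmod (fst z + snd z) = sqrt 2"
        by (simp add: \<mu>_def norm_mult norm_divide field_simps)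
      with norm_add_le_sqrt2[of z] that show False
        by simp
    qed
    obtain b where b: "(\<lambda>z. p z - P z) = polyfun (exps_upto n) b"
      using polys_upto_diff[OF p P] unfolding polys_upto_def by blast
    have "polyfun (exps_upto n) b z = 0" if "z \<in> ball 0 1" for z
      using prod[of z] f_nz[OF that] by (simp flip: b)
    then have "b s = 0" if "s \<in> exps_upto n" for s
      using polyfun_zero_on_ball_imp_coeff_zero finite_exps_upto that by blast
    then have "p z - P z = 0" for z
      using fun_cong[OF b, of z] by (simp add: polyfun_def)
    then show "p = P"
      by auto
  qed
qed

end
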